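(* Let $\mathbf A=(A,R,{}')$ be a directed relational system with involution and let $\mathbb G(\mathbf A)=(A,|)$ be a Sheffer groupoid assigned to $\mathbf A$ (for any choice of the assigned operation $|$). Then $\mathbb R(\mathbb G(\mathbf A))=\mathbf A$; that is, $\{(x,y)\in A^2\mid (x|x)|(y|y)=y\}=R$ and $x|x=x'$ for all $x\in A$.
   Context: For a binary relation $R$ on a non-empty set $A$ and $a,b\in A$, let $U(a,b):=\{x\in A\mid (a,x),(b,x)\in R\}$ and $L(a,b):=\{x\in A\mid (x,a),(x,b)\in R\}$. A directed relational system with involution is a triple $(A,R,{}')$ where $A$ is a non-empty set, $R$ is a reflexive binary relation on $A$, $U(x,y)\neq\emptyset$ and $L(x,y)\neq\emptyset$ for all $x,y\in A$, and $'$ is a unary operation on $A$ such that $x''=x$ for all $x\in A$ and $(x,y)\in R$ implies $(y',x')\in R$ for all $x,y\in A$. A binary operation $|$ on $A$ is called assigned to $\mathbf A=(A,R,{}')$ if for all $x,y\in A$: $x|y=y'$ if $(x',y')\in R$, and $x|y$ is an (arbitrary) element of $U(x',y')$ otherwise. Then $(A,|)$ is called a Sheffer groupoid assigned to $\mathbf A$ and is denoted by $\mathbb G(\mathbf A)$. (A Sheffer groupoid is a groupoid $(A,|)$, $A\ne\emptyset$, satisfying $(x|y)|(x|x)=x$ and $(x|y)|(y|y)=y$ for all $x,y$; every assigned operation makes $A$ a Sheffer groupoid.) For a Sheffer groupoid $\mathbf G=(A,|)$, $\mathbb R(\mathbf G):=(A,S,{}^* )$ where $x^*:=x|x$ for all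 $x\in A$ and $S:=\{(x,y)\in A^2\mid x^*|y^*=y\}$. *)

theory Defs
  imports Main "HOL-Library.FuncSet"
begin

definition upper_cone :: "'a set \<Rightarrow> ('a \<times> 'a) set \<Rightarrow> 'a \<Rightarrow> 'a \<Rightarrow> 'a set" where
  "upper_cone A R a b = {x \<in> A. (a, x) \<in> R \<and> (b, x) \<in> R}"

definition lower_cone :: "'a set \<Rightarrow> ('a \<times> 'a) set \<Rightarrow> 'a \<Rightarrow> 'a \<Rightarrow> 'a set" where
  "lower_cone A R a b = {x \<in> A. (x, a) \<in> R \<and> (x, b) \<in> R}"

text \<open>The carrier is a set, so the involution is an extensional function on it: two unary
  operations on the carrier are then equal as HOL functions iff they agree on the carrier,
  and equality of triples is equality of relational systems.\<close>

definition directed_relsys_inv ::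
  "'a set \<times> ('a \<times> 'a) set \<times> ('a \<Rightarrow> 'a) \<Rightarrow> bool" where
  "directed_relsys_inv = (\<lambda>(A, R, neg).
     A \<noteq> {} \<and> R \<subseteq> A \<times> A \<and> refl_on A R \<and>
     (\<forall>x\<in>A. \<forall>y\<in>A. upper_cone A R x y \<noteq> {} \<and> lower_cone A R x y \<noteq> {}) \<and>
     neg \<in> A \<rightarrow>\<^sub>E A \<and>
     (\<forall>x\<in>A. neg (neg x) = x) \<and>
     (\<forall>x\<in>A. \<forall>y\<in>A. (x, y) \<in> R \<longrightarrow> (neg y, neg x) \<in> R))"

definition assigned ::
  "'a set \<times> ('a \<times> 'a) set \<times> ('a \<Rightarrow> 'a) \<Rightarrow> ('a \<Rightarrow> 'a \<Rightarrow> 'a) \<Rightarrow> bool" where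
  "assigned = (\<lambda>(A, R, neg) f.
     f \<in> A \<rightarrow> A \<rightarrow> A \<and>
     (\<forall>x\<in>A. \<forall>y\<in>A.
        if (neg x, neg y) \<in> R then f x y = neg y
        else f x y \<in> upper_cone A R (neg x) (neg y)))"

definition sheffer_groupoid :: "'a set \<Rightarrow> ('a \<Rightarrow> 'a \<Rightarrow> 'a) \<Rightarrow> bool" where
  "sheffer_groupoid A f \<longleftrightarrow>
     A \<noteq> {} \<and> f \<in> A \<rightarrow> A \<rightarrow> A \<and>
     (\<forall>x\<in>A. \<forall>y\<in>A. f (f x y) (f x x) = x \<and> f (f x y) (f y y) = y)"

definition relsys_of_groupoid ::
  "'a set \<Rightarrow> ('a \<Rightarrow> 'a \<Rightarrow> 'a) \<Rightarrow> 'a set \<times> ('a \<times> 'a) set \<times> ('a \<Rightarrow> 'a)" where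
  "relsys_of_groupoid A f =
     (let star = (\<lambda>x\<in>A. f x x)
      in (A, {(x, y) \<in> A \<times> A. f (star x) (star y) = y}, star))"

lemma assigned_imp_sheffer_groupoid:
  assumes sys: "directed_relsys_inv (A, R, neg)" and f: "assigned (A, R, neg) f"
  shows "sheffer_groupoid A f"
proof -
  have negA: "neg x \<in> A" if "x \<in> A" for x
    using sys that by (auto simp: directed_relsys_inv_def)
  have neg2: "neg (neg x) = x" if "x \<in> A" for x
    using sys that by (auto simp: directed_relsys_inv_def)
  have refl: "(x, x) \<in> R" if "x \<in> A" for x
    using sys that by (auto simp: directed_relsys_inv_def refl_on_def)
  have anti: "(neg y, neg x) \<in> R" if "x \<in> A" "y \<in> A" "(x, y) \<in> R" for x y
    using sys that by (auto simp: directed_relsys_inv_def)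
  have fA: "f x y \<in> A" if "x \<in> A" "y \<in> A" for x y
    using f that by (auto simp: assigned_def)
  have f_le: "f x y = neg y" if "x \<in> A" "y \<in> A" "(neg x, neg y) \<in> R" for x y
    using f that by (auto simp: assigned_def)
  have f_ub: "(neg x, f x y) \<in> R \<and> (neg y, f x y) \<in> R" if "x \<in> A" "y \<in> A" for x y
  proof (cases "(neg x, neg y) \<in> R")
    case True
    then show ?thesis using that f_le refl negA by simp
  next
    case False
    have "if (neg x, neg y) \<in> R then f x y = neg y
      else f x y \<in> upper_cone A R (neg x) (neg y)"
      using f that by (simp add: assigned_def)
    with False show ?thesis by (simp add: upper_cone_def)
  qed
  have diag: "f x x = neg x" if "x \<in> A" for x
    using that f_le refl negA by simp
  have key: "f z (neg x) = x" if "x \<in> A" "z \<in> A" "(neg x, z) \<in> R" for x z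
  proof -
    have "(neg z, neg (neg x)) \<in> R" using anti negA that by blast
    then show ?thesis using f_le[of z "neg x"] that negA neg2 by simp
  qed
  have "A \<noteq> {}" using sys by (simp add: directed_relsys_inv_def)
  moreover have "f \<in> A \<rightarrow> A \<rightarrow> A" using fA by blast
  ultimately show ?thesis
    using key fA f_ub diag by (simp add: sheffer_groupoid_def)
qed

end

theory Submission
  imports Defs
begin

text \<open>The operation loses no information about the system. Reflexivity puts every diagonal
  argument into the determined case, so squaring is the involution. Evaluated at the images of
  \<open>x\<close> and \<open>y\<close> under the involution, the operation returns \<open>y\<close> if \<open>x\<close> is related to \<open>y\<close>;
  otherwise it returns some upper bound of \<open>x\<close> and \<open>y\<close>, and this bound cannot be \<open>y\<close>,
  since \<open>y\<close> is not above \<open>x\<close>. Thus the arbitrary choices never disturb the recovered relation.\<close>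

lemma assigned_diagonal:
  assumes sys: "directed_relsys_inv (A, R, neg)" and f: "assigned (A, R, neg) f"
    and x: "x \<in> A"
  shows "f x x = neg x"
proof -
  have "neg x \<in> A"
    using sys x by (auto simp: directed_relsys_inv_def)
  then have "(neg x, neg x) \<in> R"
    using sys by (auto simp: directed_relsys_inv_def refl_on_def)
  then show ?thesis
    using f x by (auto simp: assigned_def)
qed

lemma assigned_neg_eq_right_iff:
  assumes sys: "directed_relsys_inv (A, R, neg)" and f: "assigned (A, R, neg) f"
    and x: "x \<in> A" and y: "y \<in> A"
  shows "f (neg x) (neg y) = y \<longleftrightarrow> (x, y) \<in> R"
proof -
  have mem: "neg x \<in> A" "neg y \<in> A" and inv: "neg (neg x) = x" "neg (neg y) = y"
    using sys x y by (auto simp: directed_relsys_inv_def)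
  have "if (neg (neg x), neg (neg y)) \<in> R then f (neg x) (neg y) = neg (neg y)
      else f (neg x) (neg y) \<in> upper_cone A R (neg (neg x)) (neg (neg y))"
    using f mem by (simp add: assigned_def)
  then have "if (x, y) \<in> R then f (neg x) (neg y) = y
      else f (neg x) (neg y) \<in> upper_cone A R x y"
    by (simp only: inv)
  then show ?thesis
    by (auto simp: upper_cone_def split: if_splits)
qed

theorem theorem3p6:
  fixes A :: "'a set" and R :: "('a \<times> 'a) set" and neg :: "'a \<Rightarrow> 'a"
    and f :: "'a \<Rightarrow> 'a \<Rightarrow> 'a"
  assumes "directed_relsys_inv (A, R, neg)"
    and "assigned (A, R, neg) f"
  shows "relsys_of_groupoid A f = (A, R, neg) \<and>
    {(x, y) \<in> A \<times> A. f (f x x) (f y y) = y} = R \<and> (\<forall>x\<in>A. f x x = neg x)"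
proof -
  note diag = assigned_diagonal[OF assms]
  have RA: "R \<subseteq> A \<times> A" and ext: "neg \<in> A \<rightarrow>\<^sub>E A"
    using assms(1) by (auto simp: directed_relsys_inv_def)
  have star: "(\<lambda>x\<in>A. f x x) = neg"
  proof
    fix x
    show "(\<lambda>x\<in>A. f x x) x = neg x"
      using diag[of x] PiE_arb[OF ext, of x] by (cases "x \<in> A") simp_all
  qed
  have rel: "{(x, y) \<in> A \<times> A. f (neg x) (neg y) = y} = R"
    using RA by (auto simp: assigned_neg_eq_right_iff[OF assms])
  have "{(x, y) \<in> A \<times> A. f (f x x) (f y y) = y} = R"
    using RA by (auto simp: diag assigned_neg_eq_right_iff[OF assms])
  moreover have "relsys_of_groupoid A f = (A, R, neg)"
    unfolding relsys_of_groupoid_def Let_def star rel ..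
  ultimately show ?thesis
    using diag by blast
qed

end
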